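(* Consider a data generating process satisfying randomization and the strong surrogate assumption (as defined in the context), with known $\{P(S,Y\mid T=0),\,P(S\mid T=1),\,\gamma\}$, where $\gamma=\mathrm{ACE}(S\rightarrow Y)$. If $$\gamma>\min\{\,2P(Y=1,S=1\mid T=0)+P(Y=0,S=0\mid T=0),\;\; P(S=0\mid T=1)+P(Y=1,S=1\mid T=0)\,\},$$ then the surrogate paradox is excluded; that is, it is not the case that $\mathrm{ACE}(T\rightarrow S)>0$, $\mathrm{ACE}(S\rightarrow Y)>0$ and $\mathrm{ACE}(T\rightarrow Y)<0$.
   Context: $T$ (treatment), $S$ (surrogate), $Y$ (primary outcome) are binary, with values in $\{0,1\}$; $U$ is an unobserved confounder of $S$ and $Y$ taking values in an arbitrary space, with no restriction on its distribution or on how it affects $S$ and $Y$. $S_t$ is the potential value of $S$ when $T$ is set to $t$; $Y_{ts}$ is the potential value of $Y$ when $T$ is set to $t$ and $S$ to $s$; $Y_{T=t}=Y_{t,S_t}$ is the potential value of $Y$ when only $T$ is set to $t$. Observed values are $S=S_T$ and $Y=Y_{T,S_T}$. It is assumed that $0<P(T=1)<1$. Randomization: $T$ is independent of $(Y_{00},Y_{01},Y_{10},Y_{11},S_0,S_1,U)$. Strong surrogate assumption: the causal diagram with edges exactly $T\to S$, $S\to Y$, $U\to S$, $U\to Y$ is valid. In particular $Y_{ts}$ does not depend on $t$, and one writes $Y_{ts}=Y_s$, so $Y_{T=t}=Y_{S_t}$. Since $U$ is unrestricted, the joint distribution of the binary vector $(Y_0,Y_1,S_0,S_1)$ can be an arbitrary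 probability distribution on $\{0,1\}^4$, and $T$ is independent of it. Average causal effects: $\mathrm{ACE}(T\rightarrow Y)=P(Y_{T=1}=1)-P(Y_{T=0}=1)$, $\mathrm{ACE}(T\rightarrow S)=P(S_1=1)-P(S_0=1)$, and $\gamma=\mathrm{ACE}(S\rightarrow Y)=P(Y_{1}=1)-P(Y_{0}=1)$, where $Y_s$ denotes the potential outcome with $S$ set to $s$. Surrogate paradox: $\mathrm{ACE}(T\rightarrow S)>0$ and $\mathrm{ACE}(S\rightarrow Y)>0$, but $\mathrm{ACE}(T\rightarrow Y)<0$. *)

theory Defs
  imports "HOL-Probability.Probability"
begin

text \<open>
  All random variables live on one probability space \<open>M\<close>. The potential outcome \<open>S\<^sub>t\<close> is
  \<open>S t\<close> and \<open>Y\<^sub>t\<^sub>s\<close> is \<open>Y t s\<close>. They are \<open>nat\<close>-valued and \<open>nat\<close>-indexed, but only indices in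
  \<open>{0, 1}\<close> carry meaning. The confounder \<open>U\<close> takes values in an arbitrary measurable space \<open>N\<close>.
\<close>

definition binary_rv :: "'a measure \<Rightarrow> ('a \<Rightarrow> nat) \<Rightarrow> bool" where
  "binary_rv M X \<longleftrightarrow>
     X \<in> measurable M (count_space UNIV) \<and> (\<forall>\<omega>\<in>space M. X \<omega> \<in> {0, 1})"

definition binary_potential_outcomes ::
  "'a measure \<Rightarrow> 'u measure \<Rightarrow> ('a \<Rightarrow> nat) \<Rightarrow> ('a \<Rightarrow> 'u) \<Rightarrow>
   (nat \<Rightarrow> 'a \<Rightarrow> nat) \<Rightarrow> (nat \<Rightarrow> nat \<Rightarrow> 'a \<Rightarrow> nat) \<Rightarrow> bool" where
  "binary_potential_outcomes M N T U S Y \<longleftrightarrow>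
     prob_space M \<and>
     binary_rv M T \<and> U \<in> measurable M N \<and>
     (\<forall>t\<in>{0, 1}. binary_rv M (S t)) \<and>
     (\<forall>t\<in>{0, 1}. \<forall>s\<in>{0, 1}. binary_rv M (Y t s)) \<and>
     0 < \<P>(\<omega> in M. T \<omega> = 1) \<and> \<P>(\<omega> in M. T \<omega> = 1) < 1"

definition S_obs :: "('a \<Rightarrow> nat) \<Rightarrow> (nat \<Rightarrow> 'a \<Rightarrow> nat) \<Rightarrow> 'a \<Rightarrow> nat" where
  "S_obs T S \<omega> = S (T \<omega>) \<omega>"

definition Y_obs ::
  "('a \<Rightarrow> nat) \<Rightarrow> (nat \<Rightarrow> 'a \<Rightarrow> nat) \<Rightarrow> (nat \<Rightarrow> nat \<Rightarrow> 'a \<Rightarrow> nat) \<Rightarrow> 'a \<Rightarrow> nat" where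
  "Y_obs T S Y \<omega> = Y (T \<omega>) (S (T \<omega>) \<omega>) \<omega>"

text \<open>The potential outcome \<open>Y\<^bsub>T=t\<^esub> = Y\<^bsub>t,S\<^sub>t\<^esub>\<close>, when only \<open>T\<close> is set.\<close>

definition Y_set_T ::
  "(nat \<Rightarrow> 'a \<Rightarrow> nat) \<Rightarrow> (nat \<Rightarrow> nat \<Rightarrow> 'a \<Rightarrow> nat) \<Rightarrow> nat \<Rightarrow> 'a \<Rightarrow> nat" where
  "Y_set_T S Y t \<omega> = Y t (S t \<omega>) \<omega>"

text \<open>
  Independence of two random variables, that is, of the sigma-algebras they generate;
  the library's \<open>indep_var\<close> requires both variables to have the same value type.
\<close>

definition indep_rv ::
  "'a measure \<Rightarrow> 'x measure \<Rightarrow> ('a \<Rightarrow> 'x) \<Rightarrow> 'z measure \<Rightarrow> ('a \<Rightarrow> 'z) \<Rightarrow> bool" where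
  "indep_rv M MX X MZ Z \<longleftrightarrow>
     prob_space.indep_set M
       (sets (vimage_algebra (space M) X MX)) (sets (vimage_algebra (space M) Z MZ))"

definition randomization ::
  "'a measure \<Rightarrow> 'u measure \<Rightarrow> ('a \<Rightarrow> nat) \<Rightarrow> ('a \<Rightarrow> 'u) \<Rightarrow>
   (nat \<Rightarrow> 'a \<Rightarrow> nat) \<Rightarrow> (nat \<Rightarrow> nat \<Rightarrow> 'a \<Rightarrow> nat) \<Rightarrow> bool" where
  "randomization M N T U S Y \<longleftrightarrow>
     indep_rv M
       (count_space UNIV) T
       (count_space UNIV \<Otimes>\<^sub>M N)
       (\<lambda>\<omega>. ((Y 0 0 \<omega>, Y 0 1 \<omega>, Y 1 0 \<omega>, Y 1 1 \<omega>, S 0 \<omega>, S 1 \<omega>), U \<omega>))"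

text \<open>
  Conditional independence of the countably valued variables \<open>X\<close> and \<open>Z\<close> given the
  sigma-algebra generated by \<open>U\<close>.
\<close>

definition cond_indep_given ::
  "'a measure \<Rightarrow> 'u measure \<Rightarrow> ('a \<Rightarrow> 'u) \<Rightarrow> ('a \<Rightarrow> 'x) \<Rightarrow> ('a \<Rightarrow> 'z) \<Rightarrow> bool" where
  "cond_indep_given M N U X Z \<longleftrightarrow>
     (let F = vimage_algebra (space M) U N in
      \<forall>A B. AE \<omega> in M.
        real_cond_exp M F (\<lambda>\<omega>'. indicator A (X \<omega>') * indicator B (Z \<omega>')) \<omega> =
        real_cond_exp M F (\<lambda>\<omega>'. indicator A (X \<omega>')) \<omega> *
        real_cond_exp M F (\<lambda>\<omega>'. indicator B (Z \<omega>')) \<omega>)"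

text \<open>
  Validity of the causal diagram with edges exactly \<open>T \<rightarrow> S\<close>, \<open>S \<rightarrow> Y\<close>, \<open>U \<rightarrow> S\<close>, \<open>U \<rightarrow> Y\<close>.
  \<^item> There is no edge \<open>T \<rightarrow> Y\<close>: \<open>Y\<^sub>t\<^sub>s\<close> does not depend on \<open>t\<close>, and \<open>Ys s\<close> is the common
    value \<open>Y\<^sub>s\<close>.
  \<^item> There is no confounder of \<open>S\<close> and \<open>Y\<close> other than \<open>U\<close>: given \<open>U\<close>, the vectors of
    potential outcomes of \<open>S\<close> and of \<open>Y\<close> are independent. This does not restrict the joint
    law of \<open>(Y\<^sub>0, Y\<^sub>1, S\<^sub>0, S\<^sub>1)\<close>, as \<open>U\<close> may be that vector itself.
  \<^item> There is no edge or path into \<open>T\<close>: this is \<^const>\<open>randomization\<close>, which is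
    kept as a separate condition.
\<close>

definition strong_surrogate ::
  "'a measure \<Rightarrow> 'u measure \<Rightarrow> ('a \<Rightarrow> 'u) \<Rightarrow> (nat \<Rightarrow> 'a \<Rightarrow> nat) \<Rightarrow>
   (nat \<Rightarrow> nat \<Rightarrow> 'a \<Rightarrow> nat) \<Rightarrow> (nat \<Rightarrow> 'a \<Rightarrow> nat) \<Rightarrow> bool" where
  "strong_surrogate M N U S Y Ys \<longleftrightarrow>
     (\<forall>t\<in>{0, 1}. \<forall>s\<in>{0, 1}. \<forall>\<omega>\<in>space M. Y t s \<omega> = Ys s \<omega>) \<and>
     cond_indep_given M N U (\<lambda>\<omega>. (S 0 \<omega>, S 1 \<omega>)) (\<lambda>\<omega>. (Ys 0 \<omega>, Ys 1 \<omega>))"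

text \<open>
  \<open>V x\<close> is the potential value of the outcome when the cause is set to \<open>x\<close>. So
  \<open>ACE(T \<rightarrow> Y)\<close>, \<open>ACE(T \<rightarrow> S)\<close> and \<open>ACE(S \<rightarrow> Y)\<close> are the instances \<open>V = Y_set_T S Y\<close>,
  \<open>V = S\<close> and \<open>V = Ys\<close>.
\<close>

definition ACE :: "'a measure \<Rightarrow> (nat \<Rightarrow> 'a \<Rightarrow> nat) \<Rightarrow> real" where
  "ACE M V = \<P>(\<omega> in M. V 1 \<omega> = 1) - \<P>(\<omega> in M. V 0 \<omega> = 1)"

definition surrogate_paradox ::
  "'a measure \<Rightarrow> (nat \<Rightarrow> 'a \<Rightarrow> nat) \<Rightarrow> (nat \<Rightarrow> nat \<Rightarrow> 'a \<Rightarrow> nat) \<Rightarrow>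
   (nat \<Rightarrow> 'a \<Rightarrow> nat) \<Rightarrow> bool" where
  "surrogate_paradox M S Y Ys \<longleftrightarrow>
     ACE M S > 0 \<and> ACE M Ys > 0 \<and> ACE M (Y_set_T S Y) < 0"

end

theory Submission
  imports Defs
begin

text \<open>
  With \<open>D = Y\<^sub>1 - Y\<^sub>0\<close> we have \<open>ACE(S \<rightarrow> Y) = E[D]\<close> and \<open>ACE(T \<rightarrow> Y) = E[D (S\<^sub>1 - S\<^sub>0)]\<close>. The random
  variable \<open>D - D (S\<^sub>1 - S\<^sub>0)\<close> is bounded pointwise by \<open>2 Y\<^sub>1 S\<^sub>0 + (1 - Y\<^sub>0) (1 - S\<^sub>0)\<close> and by
  \<open>(1 - S\<^sub>1) + Y\<^sub>1 S\<^sub>0\<close>; by randomization the expectations of these two bounds are the terms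
  of the minimum. So \<open>ACE(T \<rightarrow> Y) < 0\<close> forces \<open>\<gamma>\<close> to be at most the minimum.
\<close>

text \<open>This is how randomization gets used: it removes the conditioning on treatment. The event
  \<open>Q (V \<omega>)\<close> is the preimage of the rectangle
  \<open>Collect Q \<times> space N\<close> under the pair, hence lies in its generated
  sigma-algebra; the product rule then cancels the positive probability of
  \<open>X \<omega> = x\<close>.\<close>

lemma (in prob_space) cond_prob_indep_rv_Pair:
  assumes ind: "indep_rv M (count_space UNIV) X (count_space UNIV \<Otimes>\<^sub>M N) (\<lambda>\<omega>. (V \<omega>, U \<omega>))"
    and U: "U \<in> measurable M N"
    and pos: "\<P>(\<omega> in M. X \<omega> = x) > 0"
  shows "\<P>(\<omega> in M. Q (V \<omega>) \<bar> X \<omega> = x) = \<P>(\<omega> in M. Q (V \<omega>))"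
proof -
  have "{\<omega> \<in> space M. X \<omega> = x} = X -` {x} \<inter> space M"
    by auto
  then have A: "{\<omega> \<in> space M. X \<omega> = x} \<in> sets (vimage_algebra (space M) X (count_space UNIV))"
    using in_vimage_algebra[of "{x}" "count_space UNIV" X "space M"] by simp
  have "{\<omega> \<in> space M. Q (V \<omega>)} = (\<lambda>\<omega>. (V \<omega>, U \<omega>)) -` (Collect Q \<times> space N) \<inter> space M"
    using measurable_space[OF U] by auto
  then have B: "{\<omega> \<in> space M. Q (V \<omega>)}
      \<in> sets (vimage_algebra (space M) (\<lambda>\<omega>. (V \<omega>, U \<omega>)) (count_space UNIV \<Otimes>\<^sub>M N))"
    using in_vimage_algebra[of "Collect Q \<times> space N" "count_space UNIV \<Otimes>\<^sub>M N"
        "\<lambda>\<omega>. (V \<omega>, U \<omega>)" "space M"]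
    by simp
  have "prob ({\<omega> \<in> space M. X \<omega> = x} \<inter> {\<omega> \<in> space M. Q (V \<omega>)})
      = \<P>(\<omega> in M. X \<omega> = x) * \<P>(\<omega> in M. Q (V \<omega>))"
    using ind A B unfolding indep_rv_def by (intro indep_setD)
  moreover have "{\<omega> \<in> space M. X \<omega> = x} \<inter> {\<omega> \<in> space M. Q (V \<omega>)}
      = {\<omega> \<in> space M. Q (V \<omega>) \<and> X \<omega> = x}"
    by auto
  ultimately show ?thesis
    using pos by (simp add: cond_prob_def)
qed

lemma cond_prob_cong:
  assumes "\<And>\<omega>. \<omega> \<in> space M \<Longrightarrow> Q \<omega> \<Longrightarrow> P \<omega> \<longleftrightarrow> P' \<omega>"
  shows "\<P>(\<omega> in M. P \<omega> \<bar> Q \<omega>) = \<P>(\<omega> in M. P' \<omega> \<bar> Q \<omega>)"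
proof -
  have "{\<omega> \<in> space M. P \<omega> \<and> Q \<omega>} = {\<omega> \<in> space M. P' \<omega> \<and> Q \<omega>}"
    using assms by auto
  then show ?thesis
    by (simp add: cond_prob_def)
qed

text \<open>For a non-measurable event both sides take the default value 0, so this is an
  unconditional rewrite rule.\<close>

lemma (in prob_space) prob_eq_expectation_of_bool:
  "\<P>(\<omega> in M. P \<omega>) = expectation (\<lambda>\<omega>. of_bool (P \<omega>))"
proof -
  have "expectation (\<lambda>\<omega>. of_bool (P \<omega>) :: real) = expectation (indicator {\<omega> \<in> space M. P \<omega>})"
    by (intro Bochner_Integration.integral_cong) (auto simp: indicator_def)
  moreover have "{\<omega> \<in> space M. P \<omega>} \<inter> space M = {\<omega> \<in> space M. P \<omega>}"
    by auto
  ultimately show ?thesis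
    by simp
qed

lemma (in prob_space) integrable_of_bool:
  assumes "{\<omega> \<in> space M. P \<omega>} \<in> events"
  shows "integrable M (\<lambda>\<omega>. of_bool (P \<omega>) :: real)"
proof -
  have "integrable M (indicator {\<omega> \<in> space M. P \<omega>} :: 'a \<Rightarrow> real)"
    using assms by (simp add: emeasure_finite less_top[symmetric])
  then show ?thesis
    by (rule Bochner_Integration.integrable_cong[THEN iffD1, rotated 2])
      (auto simp: indicator_def)
qed

text \<open>The part of the argument without observed data: \<open>V\<close> stands for
  \<open>Y_set_T S Y\<close>, and both bounds follow by integrating a pointwise inequality between
  binary values.\<close>

lemma (in prob_space) ACE_diff_le:
  fixes S Ys :: "nat \<Rightarrow> 'a \<Rightarrow> nat" and V :: "nat \<Rightarrow> 'a \<Rightarrow> nat"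
  assumes S: "\<And>t. t \<in> {0, 1} \<Longrightarrow> binary_rv M (S t)"
    and Ys: "\<And>s. s \<in> {0, 1} \<Longrightarrow> binary_rv M (Ys s)"
    and V: "\<And>t \<omega>. t \<in> {0, 1} \<Longrightarrow> \<omega> \<in> space M \<Longrightarrow> V t \<omega> = Ys (S t \<omega>) \<omega>"
  shows "ACE M Ys - ACE M V \<le>
      2 * \<P>(\<omega> in M. Ys 1 \<omega> = 1 \<and> S 0 \<omega> = 1) + \<P>(\<omega> in M. Ys 0 \<omega> = 0 \<and> S 0 \<omega> = 0)"
    and "ACE M Ys - ACE M V \<le>
      \<P>(\<omega> in M. S 1 \<omega> = 0) + \<P>(\<omega> in M. Ys 1 \<omega> = 1 \<and> S 0 \<omega> = 1)"
proof -
  have [measurable]: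
      "S 0 \<in> measurable M (count_space UNIV)" "S 1 \<in> measurable M (count_space UNIV)"
      "Ys 0 \<in> measurable M (count_space UNIV)" "Ys 1 \<in> measurable M (count_space UNIV)"
    using S Ys by (auto simp: binary_rv_def)
  have bin: "S 0 \<omega> = 0 \<or> S 0 \<omega> = 1" "S 1 \<omega> = 0 \<or> S 1 \<omega> = 1"
      "Ys 0 \<omega> = 0 \<or> Ys 0 \<omega> = 1" "Ys 1 \<omega> = 0 \<or> Ys 1 \<omega> = 1" if "\<omega> \<in> space M" for \<omega>
    using S[of 0] S[of 1] Ys[of 0] Ys[of 1] that by (auto simp: binary_rv_def)
  \<comment> \<open>The index \<open>S t \<omega>\<close> in \<open>V\<close> is random. Splitting
    on its two values leaves a Boolean combination of events with fixed indices, which yields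
    measurability.\<close>
  have Veq: "{\<omega> \<in> space M. V t \<omega> = 1} =
      {\<omega> \<in> space M. (S t \<omega> = 1 \<and> Ys 1 \<omega> = 1) \<or> (S t \<omega> = 0 \<and> Ys 0 \<omega> = 1)}"
    if "t \<in> {0, 1}" for t
    using V[OF that] bin that by force
  have Vev: "{\<omega> \<in> space M. V t \<omega> = 1} \<in> events" if "t = 0 \<or> t = 1" for t
  proof -
    have [measurable]: "S t \<in> measurable M (count_space UNIV)"
      using S[of t] that by (simp add: binary_rv_def)
    have "{\<omega> \<in> space M. (S t \<omega> = 1 \<and> Ys 1 \<omega> = 1) \<or> (S t \<omega> = 0 \<and> Ys 0 \<omega> = 1)} \<in> events"
      by measurable
    then show ?thesis
      using Veq[of t] that by auto
  qed
  note [measurable] = Vev[OF disjI1[OF refl]] Vev[OF disjI2[OF refl]]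
  have int: "integrable M (\<lambda>\<omega>. of_bool (Ys 1 \<omega> = 1) :: real)"
      "integrable M (\<lambda>\<omega>. of_bool (Ys 0 \<omega> = 1) :: real)"
      "integrable M (\<lambda>\<omega>. of_bool (V 1 \<omega> = 1) :: real)"
      "integrable M (\<lambda>\<omega>. of_bool (V 0 \<omega> = 1) :: real)"
      "integrable M (\<lambda>\<omega>. of_bool (Ys 1 \<omega> = 1 \<and> S 0 \<omega> = 1) :: real)"
      "integrable M (\<lambda>\<omega>. of_bool (Ys 0 \<omega> = 0 \<and> S 0 \<omega> = 0) :: real)"
      "integrable M (\<lambda>\<omega>. of_bool (S 1 \<omega> = 0) :: real)"
    by - (rule integrable_of_bool; measurable)+
  \<comment> \<open>This is \<open>D - D (S\<^sub>1 - S\<^sub>0)\<close>, written with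
    indicators.\<close>
  let ?diff = "\<lambda>\<omega>. (of_bool (Ys 1 \<omega> = 1) - of_bool (Ys 0 \<omega> = 1))
      - (of_bool (V 1 \<omega> = 1) - of_bool (V 0 \<omega> = 1)) :: real"
  have "ACE M Ys - ACE M V = expectation ?diff"
    unfolding ACE_def prob_eq_expectation_of_bool using int by simp
  also have "\<dots> \<le> expectation (\<lambda>\<omega>. 2 * of_bool (Ys 1 \<omega> = 1 \<and> S 0 \<omega> = 1)
      + of_bool (Ys 0 \<omega> = 0 \<and> S 0 \<omega> = 0))"
  proof (rule integral_mono)
    show "?diff \<omega> \<le> 2 * of_bool (Ys 1 \<omega> = 1 \<and> S 0 \<omega> = 1)
        + of_bool (Ys 0 \<omega> = 0 \<and> S 0 \<omega> = 0)" if "\<omega> \<in> space M" for \<omega>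
      \<comment> \<open>If D = 1, the left side is \<open>1 - S\<^sub>1 + S\<^sub>0\<close>: at most
        2 when \<open>S\<^sub>0 = 1\<close>, where the first term is 2, and at most 1 when
        \<open>S\<^sub>0 = 0\<close>, where the second term is 1. If D is 0 or -1, the left side is
        at most 0.\<close>
      using bin[OF that] V[OF _ that, of 0] V[OF _ that, of 1] by auto
  qed (use int in auto)
  also have "\<dots> = 2 * \<P>(\<omega> in M. Ys 1 \<omega> = 1 \<and> S 0 \<omega> = 1)
      + \<P>(\<omega> in M. Ys 0 \<omega> = 0 \<and> S 0 \<omega> = 0)"
    unfolding prob_eq_expectation_of_bool using int by simp
  finally show "ACE M Ys - ACE M V \<le>
      2 * \<P>(\<omega> in M. Ys 1 \<omega> = 1 \<and> S 0 \<omega> = 1) + \<P>(\<omega> in M. Ys 0 \<omega> = 0 \<and> S 0 \<omega> = 0)" .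
  have "ACE M Ys - ACE M V = expectation ?diff"
    unfolding ACE_def prob_eq_expectation_of_bool using int by simp
  also have "\<dots> \<le> expectation (\<lambda>\<omega>. of_bool (S 1 \<omega> = 0) + of_bool (Ys 1 \<omega> = 1 \<and> S 0 \<omega> = 1))"
  proof (rule integral_mono)
    show "?diff \<omega> \<le> of_bool (S 1 \<omega> = 0) + of_bool (Ys 1 \<omega> = 1 \<and> S 0 \<omega> = 1)"
      if "\<omega> \<in> space M" for \<omega>
      \<comment> \<open>The left side is \<open>D (1 - S\<^sub>1 + S\<^sub>0)\<close> with a
        nonnegative second factor: equality for D = 1, and at most 0 otherwise.\<close>
      using bin[OF that] V[OF _ that, of 0] V[OF _ that, of 1] by auto
  qed (use int in auto)
  also have "\<dots> = \<P>(\<omega> in M. S 1 \<omega> = 0) + \<P>(\<omega> in M. Ys 1 \<omega> = 1 \<and> S 0 \<omega> = 1)"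
    unfolding prob_eq_expectation_of_bool using int by simp
  finally show "ACE M Ys - ACE M V \<le>
      \<P>(\<omega> in M. S 1 \<omega> = 0) + \<P>(\<omega> in M. Ys 1 \<omega> = 1 \<and> S 0 \<omega> = 1)" .
qed

theorem theorem2:
  fixes M :: "'a measure" and N :: "'u measure"
    and T :: "'a \<Rightarrow> nat" and U :: "'a \<Rightarrow> 'u"
    and S :: "nat \<Rightarrow> 'a \<Rightarrow> nat" and Y :: "nat \<Rightarrow> nat \<Rightarrow> 'a \<Rightarrow> nat"
    and Ys :: "nat \<Rightarrow> 'a \<Rightarrow> nat" and \<gamma> :: real
  assumes "binary_potential_outcomes M N T U S Y"
    and "randomization M N T U S Y"
    and "strong_surrogate M N U S Y Ys"
    and "\<gamma> = ACE M Ys"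
    and "\<gamma> > min
          (2 * \<P>(\<omega> in M. Y_obs T S Y \<omega> = 1 \<and> S_obs T S \<omega> = 1 \<bar> T \<omega> = 0)
            + \<P>(\<omega> in M. Y_obs T S Y \<omega> = 0 \<and> S_obs T S \<omega> = 0 \<bar> T \<omega> = 0))
          (\<P>(\<omega> in M. S_obs T S \<omega> = 0 \<bar> T \<omega> = 1)
            + \<P>(\<omega> in M. Y_obs T S Y \<omega> = 1 \<and> S_obs T S \<omega> = 1 \<bar> T \<omega> = 0))"
  shows "\<not> surrogate_paradox M S Y Ys"
proof -
  interpret prob_space M
    using assms(1) by (simp add: binary_potential_outcomes_def)
  have T: "binary_rv M T" and U: "U \<in> measurable M N"
    and S: "\<And>t. t \<in> {0, 1} \<Longrightarrow> binary_rv M (S t)"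
    and Y: "\<And>t s. t \<in> {0, 1} \<Longrightarrow> s \<in> {0, 1} \<Longrightarrow> binary_rv M (Y t s)"
    and T1: "0 < \<P>(\<omega> in M. T \<omega> = 1)" "\<P>(\<omega> in M. T \<omega> = 1) < 1"
    using assms(1) unfolding binary_potential_outcomes_def by blast+
  have YYs: "Y t s \<omega> = Ys s \<omega>" if "t \<in> {0, 1}" "s \<in> {0, 1}" "\<omega> \<in> space M" for t s \<omega>
    using assms(3) that unfolding strong_surrogate_def by blast
  have Sbin: "S t \<omega> \<in> {0, 1}" if "t \<in> {0, 1}" "\<omega> \<in> space M" for t \<omega>
    using S[OF that(1)] that(2) unfolding binary_rv_def by blast
  \<comment> \<open>\<open>Ys\<close> is tied to \<open>Y\<close> only on \<open>space M\<close>, so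
    measurability is transferred by congruence.\<close>
  have Ys: "binary_rv M (Ys s)" if "s \<in> {0, 1}" for s
  proof -
    have "Ys s \<in> measurable M (count_space UNIV) \<longleftrightarrow> Y 0 s \<in> measurable M (count_space UNIV)"
      using YYs[of 0 s] that by (intro measurable_cong) simp
    then show ?thesis
      using Y[of 0 s] YYs[of 0 s] that by (simp add: binary_rv_def)
  qed
  have [measurable]: "T \<in> measurable M (count_space UNIV)"
    using T by (simp add: binary_rv_def)
  \<comment> \<open>Conditioning on \<open>T \<omega> = 0\<close> needs positive probability; for
    binary \<open>T\<close> this is the complement of \<open>T \<omega> = 1\<close>.\<close>
  have "{\<omega> \<in> space M. T \<omega> = 1} \<in> events"
    by measurable
  then have "\<P>(\<omega> in M. T \<omega> \<noteq> 1) = 1 - \<P>(\<omega> in M. T \<omega> = 1)"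
    by (rule prob_neg)
  moreover have "{\<omega> \<in> space M. T \<omega> \<noteq> 1} = {\<omega> \<in> space M. T \<omega> = 0}"
    using T by (auto simp: binary_rv_def)
  ultimately have T0: "0 < \<P>(\<omega> in M. T \<omega> = 0)"
    using T1(2) by simp
  note cond = cond_prob_indep_rv_Pair[OF assms(2)[unfolded randomization_def] U]

  \<comment> \<open>Three moves: on \<open>T \<omega> = 0\<close> the observed values are potential
    outcomes, randomization drops the conditioning, and the absence of a direct effect of treatment
    turns \<open>Y 0 1\<close> into \<open>Ys 1\<close>.\<close>
  have "\<P>(\<omega> in M. Y_obs T S Y \<omega> = 1 \<and> S_obs T S \<omega> = 1 \<bar> T \<omega> = 0)
      = \<P>(\<omega> in M. Y 0 1 \<omega> = 1 \<and> S 0 \<omega> = 1 \<bar> T \<omega> = 0)"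
    by (rule cond_prob_cong) (auto simp: Y_obs_def S_obs_def)
  also have "\<dots> = \<P>(\<omega> in M. Y 0 1 \<omega> = 1 \<and> S 0 \<omega> = 1)"
    using cond[OF T0, of "\<lambda>(y00, y01, y10, y11, s0, s1). y01 = 1 \<and> s0 = 1"] by simp
  also have "{\<omega> \<in> space M. Y 0 1 \<omega> = 1 \<and> S 0 \<omega> = 1} = {\<omega> \<in> space M. Ys 1 \<omega> = 1 \<and> S 0 \<omega> = 1}"
    using YYs by auto
  finally have 11: "\<P>(\<omega> in M. Y_obs T S Y \<omega> = 1 \<and> S_obs T S \<omega> = 1 \<bar> T \<omega> = 0)
      = \<P>(\<omega> in M. Ys 1 \<omega> = 1 \<and> S 0 \<omega> = 1)" .

  have "\<P>(\<omega> in M. Y_obs T S Y \<omega> = 0 \<and> S_obs T S \<omega> = 0 \<bar> T \<omega> = 0)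
      = \<P>(\<omega> in M. Y 0 0 \<omega> = 0 \<and> S 0 \<omega> = 0 \<bar> T \<omega> = 0)"
    by (rule cond_prob_cong) (auto simp: Y_obs_def S_obs_def)
  also have "\<dots> = \<P>(\<omega> in M. Y 0 0 \<omega> = 0 \<and> S 0 \<omega> = 0)"
    using cond[OF T0, of "\<lambda>(y00, y01, y10, y11, s0, s1). y00 = 0 \<and> s0 = 0"] by simp
  also have "{\<omega> \<in> space M. Y 0 0 \<omega> = 0 \<and> S 0 \<omega> = 0} = {\<omega> \<in> space M. Ys 0 \<omega> = 0 \<and> S 0 \<omega> = 0}"
    using YYs by auto
  finally have 00: "\<P>(\<omega> in M. Y_obs T S Y \<omega> = 0 \<and> S_obs T S \<omega> = 0 \<bar> T \<omega> = 0)
      = \<P>(\<omega> in M. Ys 0 \<omega> = 0 \<and> S 0 \<omega> = 0)" .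

  have "\<P>(\<omega> in M. S_obs T S \<omega> = 0 \<bar> T \<omega> = 1) = \<P>(\<omega> in M. S 1 \<omega> = 0 \<bar> T \<omega> = 1)"
    by (rule cond_prob_cong) (auto simp: S_obs_def)
  also have "\<dots> = \<P>(\<omega> in M. S 1 \<omega> = 0)"
    using cond[OF T1(1), of "\<lambda>(y00, y01, y10, y11, s0, s1). s1 = 0"] by simp
  finally have S0: "\<P>(\<omega> in M. S_obs T S \<omega> = 0 \<bar> T \<omega> = 1) = \<P>(\<omega> in M. S 1 \<omega> = 0)" .

  \<comment> \<open>\<open>Sbin\<close> allows \<open>YYs\<close> to be applied at the random index
    \<open>S t \<omega>\<close>.\<close>
  have V: "Y_set_T S Y t \<omega> = Ys (S t \<omega>) \<omega>" if "t \<in> {0, 1}" "\<omega> \<in> space M" for t \<omega>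
    using YYs[OF that(1) Sbin[OF that] that(2)] by (simp add: Y_set_T_def)
  \<comment> \<open>Exceeding the minimum means exceeding one of its two terms, and the matching
    bound makes the effect positive. This contradicts the last condition of the paradox.\<close>
  have "0 < ACE M (Y_set_T S Y)"
    using assms(4,5) ACE_diff_le[of S Ys "Y_set_T S Y", OF S Ys V] unfolding 11 00 S0 by linarith
  then show ?thesis
    by (simp add: surrogate_paradox_def)
qed

end
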